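(* If $G$ is a vertex-transitive graph, then $\chi_f(G) \le \max\left\{\omega(G),\, \frac{5}{6}(\Delta(G) + 1)\right\}$.
   Context: Graphs are finite, simple, undirected and nonempty. A graph is vertex-transitive if its automorphism group acts transitively on its vertices. $\omega(G)$ is the clique number and $\Delta(G)$ the maximum degree of $G$. $\chi_f(G)$ is the fractional chromatic number: the minimum of $\sum_{I} w(I)$ over all assignments of nonnegative real weights $w(I)$ to the independent sets $I$ of $G$ such that $\sum_{I \ni v} w(I) \ge 1$ for every vertex $v$ of $G$. *)

theory Defs
  imports "HOL-Analysis.Analysis" "Graph_Theory.Graph_Theory"
begin

text \<open>
  A finite simple undirected graph is a \<^locale>\<open>pair_graph\<close>: an edge $uv$ is represented by the two
  arcs $(u,v)$ and $(v,u)$. The library allows the null graph, so nonemptiness is always a separate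
  hypothesis.
\<close>

definition automorphism :: "'a pair_pre_digraph \<Rightarrow> ('a \<Rightarrow> 'a) \<Rightarrow> bool" where
  "automorphism G f \<longleftrightarrow> bij_betw f (pverts G) (pverts G) \<and>
     (\<forall>u\<in>pverts G. \<forall>v\<in>pverts G. (f u, f v) \<in> parcs G \<longleftrightarrow> (u, v) \<in> parcs G)"

definition vertex_transitive :: "'a pair_pre_digraph \<Rightarrow> bool" where
  "vertex_transitive G \<longleftrightarrow>
     (\<forall>u\<in>pverts G. \<forall>v\<in>pverts G. \<exists>f. automorphism G f \<and> f u = v)"

definition cliques :: "'a pair_pre_digraph \<Rightarrow> 'a set set" where
  "cliques G = {K. K \<subseteq> pverts G \<and> (\<forall>u\<in>K. \<forall>v\<in>K. u \<noteq> v \<longrightarrow> (u, v) \<in> parcs G)}"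

definition clique_number :: "'a pair_pre_digraph \<Rightarrow> nat" where
  "clique_number G = Max (card ` cliques G)"

text \<open>
  Every edge at $v$ contributes exactly one arc with tail $v$, so the out-degree is the usual degree.
\<close>

definition max_degree :: "'a pair_pre_digraph \<Rightarrow> nat" where
  "max_degree G = Max (out_degree (with_proj G) ` pverts G)"

definition independent_sets :: "'a pair_pre_digraph \<Rightarrow> 'a set set" where
  "independent_sets G = {I. I \<subseteq> pverts G \<and> (\<forall>u\<in>I. \<forall>v\<in>I. (u, v) \<notin> parcs G)}"

definition fractional_colouring :: "'a pair_pre_digraph \<Rightarrow> ('a set \<Rightarrow> real) \<Rightarrow> bool" where
  "fractional_colouring G w \<longleftrightarrow> (\<forall>I\<in>independent_sets G. 0 \<le> w I) \<and>
     (\<forall>v\<in>pverts G. 1 \<le> (\<Sum>I | I \<in> independent_sets G \<and> v \<in> I. w I))"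

definition total_weight :: "'a pair_pre_digraph \<Rightarrow> ('a set \<Rightarrow> real) \<Rightarrow> real" where
  "total_weight G w = (\<Sum>I\<in>independent_sets G. w I)"

text \<open>
  The infimum is a minimum; see \<open>fractional_chromatic_number_attained\<close> and
  \<open>fractional_chromatic_number_le\<close> below.
\<close>

definition fractional_chromatic_number :: "'a pair_pre_digraph \<Rightarrow> real" where
  "fractional_chromatic_number G = (INF w\<in>Collect (fractional_colouring G). total_weight G w)"

lemma finite_independent_sets:
  assumes "pair_graph G"
  shows "finite (independent_sets G)"
proof -
  have "finite (pverts G)"
    using assms by (simp add: pair_graph_def pair_digraph_def pair_fin_digraph.pair_finite_verts)
  then show ?thesis
    by (rule finite_subset[rotated, OF finite_Pow_iff[THEN iffD2]]) (auto simp: independent_sets_def)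
qed

lemma fractional_chromatic_number_le:
  assumes "fractional_colouring G w"
  shows "fractional_chromatic_number G \<le> total_weight G w"
  unfolding fractional_chromatic_number_def
proof (rule cINF_lower)
  show "bdd_below (total_weight G ` Collect (fractional_colouring G))"
    by (rule bdd_belowI[of _ 0])
       (auto simp: total_weight_def fractional_colouring_def intro: sum_nonneg)
qed (use assms in simp)

lemma fractional_chromatic_number_attained:
  assumes G: "pair_graph G"
  obtains w where "fractional_colouring G w" "fractional_chromatic_number G = total_weight G w"
proof -
  have fin: "finite (independent_sets G)"
    using G by (rule finite_independent_sets)
  have loopfree: "(v, v) \<notin> parcs G" for v
    using G pair_loopfree_digraph.pair_no_loops[of G "(v, v)"]
    by (auto simp: pair_graph_def pair_digraph_def)
  define B where "B = (\<lambda>I. if I \<in> independent_sets G then {0..1::real} else {0})"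
  define K where "K = PiE UNIV B \<inter>
    {w. \<forall>v\<in>pverts G. 1 \<le> (\<Sum>I | I \<in> independent_sets G \<and> v \<in> I. w I)}"
  have K_sub: "fractional_colouring G w" if "w \<in> K" for w
    using that by (auto simp: K_def B_def fractional_colouring_def PiE_def Pi_def split: if_splits)
  have cov: "(\<Sum>I | I \<in> independent_sets G \<and> v \<in> I. min 1 (w I)) \<ge> 1"
    if w: "fractional_colouring G w" and v: "v \<in> pverts G" for w v
  proof (cases "\<exists>J. J \<in> independent_sets G \<and> v \<in> J \<and> 1 \<le> w J")
    case True
    then obtain J where J: "J \<in> independent_sets G" "v \<in> J" "1 \<le> w J" by blast
    have "min 1 (w J) \<le> (\<Sum>I | I \<in> independent_sets G \<and> v \<in> I. min 1 (w I))"
      by (rule member_le_sum) (use J w fin in \<open>auto simp: fractional_colouring_def\<close>)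
    then show ?thesis using J by simp
  next
    case False
    then have "(\<Sum>I | I \<in> independent_sets G \<and> v \<in> I. min 1 (w I)) =
        (\<Sum>I | I \<in> independent_sets G \<and> v \<in> I. w I)"
      by (intro sum.cong) (auto simp: not_le)
    then show ?thesis using w v by (simp add: fractional_colouring_def)
  qed
  have trunc: "\<exists>w'\<in>K. total_weight G w' \<le> total_weight G w" if w: "fractional_colouring G w" for w
  proof
    let ?w' = "\<lambda>I. if I \<in> independent_sets G then min 1 (w I) else 0"
    have "(\<Sum>I | I \<in> independent_sets G \<and> v \<in> I. ?w' I) =
        (\<Sum>I | I \<in> independent_sets G \<and> v \<in> I. min 1 (w I))" for v
      by (intro sum.cong) auto
    then show "?w' \<in> K"
      using w cov[OF w] by (auto simp: K_def B_def fractional_colouring_def)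
    show "total_weight G ?w' \<le> total_weight G w"
      unfolding total_weight_def by (intro sum_mono) auto
  qed
  have cont: "continuous_on UNIV (\<lambda>w :: 'a set \<Rightarrow> real. \<Sum>I\<in>A. w I)" for A
    by (intro continuous_intros continuous_on_product_coordinates)
  have cl: "closed {w :: 'a set \<Rightarrow> real. 1 \<le> (\<Sum>I\<in>A. w I)}" for A
    using closed_Collect_le[OF continuous_on_const cont[of A]] .
  have "compact (PiE UNIV B)"
    using compactin_PiE[of "\<lambda>_. euclidean" UNIV B]
    by (auto simp: B_def euclidean_product_topology)
  moreover have "closed {w :: 'a set \<Rightarrow> real.
      \<forall>v\<in>pverts G. 1 \<le> (\<Sum>I | I \<in> independent_sets G \<and> v \<in> I. w I)}"
    unfolding Ball_def by (intro closed_Collect_all closed_Collect_imp open_Collect_const cl)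
  ultimately have "compact K"
    unfolding K_def by (rule compact_Int_closed)
  have "fractional_colouring G (\<lambda>_. 1)"
    unfolding fractional_colouring_def
  proof (intro conjI ballI)
    fix v assume "v \<in> pverts G"
    then have "{v} \<in> {I. I \<in> independent_sets G \<and> v \<in> I}"
      using loopfree by (auto simp: independent_sets_def)
    then show "(1::real) \<le> (\<Sum>I | I \<in> independent_sets G \<and> v \<in> I. 1)"
      using fin by (intro member_le_sum[of "{v}" _ "\<lambda>_. 1::real"]) simp_all
  qed simp
  then have "K \<noteq> {}" using trunc by blast
  have "continuous_on K (total_weight G)"
    unfolding total_weight_def by (rule continuous_on_subset[OF cont]) simp
  then obtain w where w: "w \<in> K" and min: "\<forall>w'\<in>K. total_weight G w \<le> total_weight G w'"
    using continuous_attains_inf[OF \<open>compact K\<close> \<open>K \<noteq> {}\<close>] by blast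
  have "total_weight G w \<le> fractional_chromatic_number G"
    unfolding fractional_chromatic_number_def
  proof (rule cINF_greatest)
    show "Collect (fractional_colouring G) \<noteq> {}"
      using K_sub[OF w] by blast
    show "total_weight G w \<le> total_weight G w'" if "w' \<in> Collect (fractional_colouring G)" for w'
      proof -
      have "fractional_colouring G w'" using that by simp
      then obtain w'' where "w'' \<in> K" "total_weight G w'' \<le> total_weight G w'"
        using trunc by blast
      with min show ?thesis by (meson order_trans)
    qed
  qed
  then show ?thesis
    using that[OF K_sub[OF w]] fractional_chromatic_number_le[OF K_sub[OF w]] by linarith
qed

end

theory Submission
  imports Defs
begin

text \<open>
  Write $n$, $\omega$, $\Delta$ for the order, clique number and maximum degree of $G$. By symmetry
  it suffices to find a large independent set $T$: every vertex lies in the same number of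
  independent sets of size $|T|$, so uniform weights on these give $\chi_f(G) \le n / |T|$
  (\<open>fractional_chromatic_number_le_ratio\<close>). The two terms of the maximum come from two ways of
  finding $T$, according to whether $\omega$ exceeds $\frac23(\Delta + 1)$.

  If $\omega \le \frac23(\Delta + 1)$, a double count over all maximum independent sets yields one
  with $|T| \ge 2n / (\Delta + \omega + 1)$ (\<open>independence_ratio_lower_bound\<close>), the bound behind
  the fractional form of Reed's conjecture due to Molloy and Reed. Then
  $\chi_f(G) \le (\Delta + \omega + 1)/2 \le \frac56 (\Delta + 1)$.

  If $\omega > \frac23(\Delta + 1)$, intersecting maximum cliques overlap in so many vertices that,
  by symmetry, they must coincide: the maximum cliques partition the vertex set
  (\<open>unique_maximum_clique\<close>). A vertex has fewer than $\omega/2$ neighbours outside its own clique,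
  so Haxell's theorem on independent transversals (\<open>independent_transversal_exists\<close>) provides an
  independent set with one vertex in each of the $n/\omega$ cliques, and $\chi_f(G) \le \omega$.
\<close>

section \<open>Neighbourhoods, cliques and automorphisms\<close>

definition nbrs :: "'a pair_pre_digraph \<Rightarrow> 'a \<Rightarrow> 'a set" where
  "nbrs G v = {u. (v, u) \<in> parcs G}"

lemma pair_graph_facts:
  assumes "pair_graph G"
  shows finite_pverts: "finite (pverts G)"
    and arc_sym: "(u, v) \<in> parcs G \<longleftrightarrow> (v, u) \<in> parcs G"
    and arc_irrefl: "(v, v) \<notin> parcs G"
    and arc_in_pverts: "(u, v) \<in> parcs G \<Longrightarrow> u \<in> pverts G \<and> v \<in> pverts G"
proof -
  interpret pair_graph G by fact
  show "finite (pverts G)" by simp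
  show "(u, v) \<in> parcs G \<longleftrightarrow> (v, u) \<in> parcs G"
    using arcs_symmetric by blast
  show "(v, v) \<notin> parcs G"
    using pair_no_loops[of "(v, v)"] by auto
  show "u \<in> pverts G \<and> v \<in> pverts G" if "(u, v) \<in> parcs G"
    using in_arcsD1[of u v] in_arcsD2[of u v] that by auto
qed

lemma nbrs_subset:
  assumes "pair_graph G"
  shows "nbrs G v \<subseteq> pverts G" "finite (nbrs G v)"
proof -
  show "nbrs G v \<subseteq> pverts G"
    using arc_in_pverts[OF assms] by (auto simp: nbrs_def)
  then show "finite (nbrs G v)"
    using finite_pverts[OF assms] finite_subset by blast
qed

lemma card_nbrs_le_max_degree:
  assumes "pair_graph G" "v \<in> pverts G"
  shows "card (nbrs G v) \<le> max_degree G"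
proof -
  have "out_arcs (with_proj G) v = Pair v ` nbrs G v"
    by (auto simp: out_arcs_def nbrs_def)
  then have "out_degree (with_proj G) v = card (nbrs G v)"
    by (simp add: out_degree_def card_image inj_on_def)
  then show ?thesis
    unfolding max_degree_def using assms finite_pverts[OF assms(1)]
    by (metis Max_ge finite_imageI imageI)
qed

lemma finite_cliques:
  assumes "pair_graph G"
  shows "finite (cliques G)"
  by (rule finite_subset[of _ "Pow (pverts G)"])
     (use finite_pverts[OF assms] in \<open>auto simp: cliques_def\<close>)

lemma card_clique_le:
  assumes "pair_graph G" "K \<in> cliques G"
  shows "card K \<le> clique_number G"
  unfolding clique_number_def using assms finite_cliques[OF assms(1)] by simp

lemma maximum_clique_exists:
  assumes "pair_graph G"
  obtains K where "K \<in> cliques G" "card K = clique_number G"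
proof -
  have "{} \<in> cliques G" by (simp add: cliques_def)
  then have "clique_number G \<in> card ` cliques G"
    unfolding clique_number_def using finite_cliques[OF assms] by (intro Max_in) auto
  then show ?thesis using that by auto
qed

lemma automorphism_image:
  assumes "automorphism G f" "A \<subseteq> pverts G"
  shows "f ` A \<subseteq> pverts G" "card (f ` A) = card A"
proof -
  show "f ` A \<subseteq> pverts G"
    using assms by (auto simp: automorphism_def bij_betw_def)
  show "card (f ` A) = card A"
    using assms by (intro card_image) (auto simp: automorphism_def bij_betw_def inj_on_subset)
qed

lemma automorphism_image_clique:
  assumes "automorphism G f" "K \<in> cliques G"
  shows "f ` K \<in> cliques G"
  using assms automorphism_image(1)[OF assms(1), of K]
  unfolding cliques_def automorphism_def by (auto simp: subset_iff)

lemma automorphism_image_independent: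
  assumes "automorphism G f" "I \<in> independent_sets G"
  shows "f ` I \<in> independent_sets G"
  using assms automorphism_image(1)[OF assms(1), of I]
  unfolding independent_sets_def automorphism_def by (auto simp: subset_iff)

text \<open>
  An automorphism taking $u$ to $v$ maps the members of $F$ through $u$ injectively to members
  through $v$; exchanging the roles of $u$ and $v$ gives the reverse inequality.
\<close>

lemma card_containing_const:
  assumes G: "pair_graph G" "vertex_transitive G"
    and F: "F \<subseteq> Pow (pverts G)" "\<And>f A. automorphism G f \<Longrightarrow> A \<in> F \<Longrightarrow> f ` A \<in> F"
    and uv: "u \<in> pverts G" "v \<in> pverts G"
  shows "card {A \<in> F. u \<in> A} = card {A \<in> F. v \<in> A}"
proof -
  have fin: "finite F"
    using F(1) finite_pverts[OF G(1)] finite_subset by blast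
  have le: "card {A \<in> F. x \<in> A} \<le> card {A \<in> F. y \<in> A}"
    if xy: "x \<in> pverts G" "y \<in> pverts G" for x y
  proof -
    obtain f where f: "automorphism G f" "f x = y"
      using G(2) xy unfolding vertex_transitive_def by blast
    then have "inj_on f (pverts G)"
      by (simp add: automorphism_def bij_betw_def)
    then have "inj_on ((`) f) {A \<in> F. x \<in> A}"
      using F(1) by (intro inj_on_subset[OF inj_on_image_Pow]) auto
    then show ?thesis
      by (rule card_inj_on_le) (use f F(2) fin in auto)
  qed
  show ?thesis using le uv by (simp add: le_antisym)
qed

lemma sum_card_containing:
  assumes "finite V" "finite F" "F \<subseteq> Pow V"
  shows "(\<Sum>v\<in>V. card {A \<in> F. v \<in> A}) = (\<Sum>A\<in>F. card A)"
proof -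
  have "(\<Sum>v\<in>V. card {A \<in> F. v \<in> A}) = (\<Sum>v\<in>V. \<Sum>A | A \<in> F \<and> v \<in> A. 1)"
    by simp
  also have "\<dots> = (\<Sum>A\<in>F. \<Sum>v | v \<in> V \<and> v \<in> A. 1)"
    by (rule sum.swap_restrict) (use assms in auto)
  also have "\<dots> = (\<Sum>A\<in>F. card A)"
    by (intro sum.cong) (use assms in \<open>auto intro!: arg_cong[where f = card]\<close>)
  finally show ?thesis .
qed

section \<open>Fractional colourings from a single independent set\<close>

text \<open>
  Let $F$ be the family of all independent sets of size $|T|$ and $a$ the number of them through
  a vertex, which does not depend on the vertex. Weight $1/a$ on each member of $F$ covers every
  vertex exactly once, and $|F| \cdot |T| = n a$ by double counting, so the total weight $|F|/a$ is
  $n/|T|$.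
\<close>

lemma fractional_chromatic_number_le_ratio:
  assumes G: "pair_graph G" "vertex_transitive G"
    and T: "T \<in> independent_sets G" "T \<noteq> {}"
  shows "fractional_chromatic_number G \<le> real (card (pverts G)) / real (card T)"
proof -
  define F where "F = {I \<in> independent_sets G. card I = card T}"
  have fin: "finite (independent_sets G)" "finite F"
    using finite_independent_sets[OF G(1)] by (auto simp: F_def)
  have FV: "F \<subseteq> Pow (pverts G)"
    by (auto simp: F_def independent_sets_def)
  have FT: "T \<in> F" using T by (simp add: F_def)
  obtain t where t: "t \<in> T" using T by blast
  have tV: "t \<in> pverts G" using t FT FV by blast
  define a where "a = card {A \<in> F. t \<in> A}"
  have inv: "f ` A \<in> F" if "automorphism G f" "A \<in> F" for f A
    using that automorphism_image_independent[of G f A] automorphism_image(2)[of G f A] FV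
    by (auto simp: F_def)
  have const: "card {A \<in> F. v \<in> A} = a" if "v \<in> pverts G" for v
    unfolding a_def using card_containing_const[OF G FV inv] that tV by blast
  have a: "a > 0"
    unfolding a_def using fin t FT by (subst card_gt_0_iff) auto
  have finT: "finite T"
    using FT FV finite_pverts[OF G(1)] finite_subset by blast
  have count: "card (pverts G) * a = card F * card T"
    using sum_card_containing[OF finite_pverts[OF G(1)] fin(2) FV] const
    by (simp add: F_def)
  define w where "w = (\<lambda>I. if I \<in> F then 1 / real a else 0)"
  have "fractional_colouring G w"
    unfolding fractional_colouring_def
  proof (intro conjI ballI)
    fix v assume v: "v \<in> pverts G"
    have "(\<Sum>I | I \<in> independent_sets G \<and> v \<in> I. w I) = (\<Sum>I | I \<in> F \<and> v \<in> I. 1 / real a)"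
      unfolding w_def by (rule sum.mono_neutral_cong_right) (use fin in \<open>auto simp: F_def\<close>)
    also have "\<dots> = 1" using const[OF v] a by simp
    finally show "1 \<le> (\<Sum>I | I \<in> independent_sets G \<and> v \<in> I. w I)" by simp
  qed (simp add: w_def)
  then have "fractional_chromatic_number G \<le> total_weight G w"
    by (rule fractional_chromatic_number_le)
  also have "total_weight G w = (\<Sum>I\<in>F. 1 / real a)"
    unfolding w_def total_weight_def
    by (rule sum.mono_neutral_cong_right) (use fin in \<open>auto simp: F_def\<close>)
  also have "\<dots> = real (card (pverts G)) / real (card T)"
    using arg_cong[OF count, of real] a finT T(2) by (simp add: field_simps card_gt_0_iff)
  finally show ?thesis .
qed

section \<open>A lower bound on the independence number\<close>

lemma independent_set_insert:
  assumes G: "pair_graph G" and "S \<in> independent_sets G" "v \<in> pverts G" "nbrs G v \<inter> S = {}"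
  shows "insert v S \<in> independent_sets G"
  using assms arc_sym[OF G] arc_irrefl[OF G] by (auto simp: independent_sets_def nbrs_def)

text \<open>
  If $v$ has exactly one neighbour $u$ in a maximum independent set $S$, then $S - u + v$ is a
  maximum independent set through $v$. Conversely, from a maximum independent set $S \ni v$ one
  recovers $S - v + u$ for those neighbours $u$ of $v$ whose only neighbour in $S$ is $v$. These $u$
  are pairwise adjacent, since two that are not could both replace $v$ and enlarge $S$. Together
  with $v$ they form a clique, so there are at most $\omega - 1$ of them.
\<close>

lemma card_maximum_independent_sets_one_nbr:
  assumes G: "pair_graph G" and v: "v \<in> pverts G"
    and max: "\<And>I. I \<in> independent_sets G \<Longrightarrow> card I \<le> m"
  defines "M \<equiv> {S \<in> independent_sets G. card S = m}"
  shows "card {S \<in> M. card (S \<inter> nbrs G v) = 1}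
    \<le> card {S \<in> M. v \<in> S} * (clique_number G - 1)"
proof -
  \<comment> \<open>the neighbours of \<open>v\<close> that can be exchanged for \<open>v\<close>\<close>
  define U where "U = (\<lambda>S. {u \<in> nbrs G v. nbrs G u \<inter> S = {v}})"
  have finM: "finite M" using finite_independent_sets[OF G] by (simp add: M_def)
  have finS: "finite S" if "S \<in> independent_sets G" for S
    using that finite_pverts[OF G] finite_subset by (auto simp: independent_sets_def)
  have finU: "finite (U S)" for S
    using nbrs_subset(2)[OF G] by (auto simp: U_def)
  have vU: "v \<notin> U S" for S
    using arc_irrefl[OF G] by (auto simp: U_def nbrs_def)
  have cardU: "card (U S) \<le> clique_number G - 1" if S: "S \<in> M" "v \<in> S" for S
  proof -
    have ind: "S \<in> independent_sets G" and cS: "card S = m" using S by (auto simp: M_def)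
    have UV: "U S \<subseteq> pverts G" using nbrs_subset[OF G] by (auto simp: U_def)
    have ad: "(x, y) \<in> parcs G" if xy: "x \<in> U S" "y \<in> U S" "x \<noteq> y" for x y
    proof (rule ccontr)
      assume nadj: "(x, y) \<notin> parcs G"
      have xv: "x \<notin> S" "y \<notin> S"
        using xy ind S by (auto simp: U_def nbrs_def independent_sets_def)
      have xyV: "x \<in> pverts G" "y \<in> pverts G" using xy UV by auto
      have S': "S - {v} \<in> independent_sets G" using ind by (auto simp: independent_sets_def)
      have 1: "insert x (S - {v}) \<in> independent_sets G"
        by (rule independent_set_insert[OF G S']) (use xy xyV in \<open>auto simp: U_def\<close>)
      have "insert y (insert x (S - {v})) \<in> independent_sets G"
        by (rule independent_set_insert[OF G 1])
           (use xy xyV nadj arc_sym[OF G] in \<open>auto simp: U_def nbrs_def\<close>)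
      then have "card (insert y (insert x (S - {v}))) \<le> m" by (rule max)
      moreover have "Suc (card (S - {v})) = m"
        using card_Suc_Diff1[OF finS[OF ind] S(2)] cS by simp
      then have "card (insert y (insert x (S - {v}))) = Suc m"
        using xy(3) xv finS[OF ind] by simp
      ultimately show False by simp
    qed
    have vU': "(v, x) \<in> parcs G \<and> (x, v) \<in> parcs G" if "x \<in> U S" for x
      using that arc_sym[OF G, of x v] by (simp add: U_def nbrs_def)
    have "insert v (U S) \<in> cliques G"
      unfolding cliques_def using v UV ad vU' by blast
    from card_clique_le[OF G this] show ?thesis using finU vU by simp
  qed
  have "{S \<in> M. card (S \<inter> nbrs G v) = 1}
      \<subseteq> (\<Union>S\<in>{S \<in> M. v \<in> S}. (\<lambda>u. insert u (S - {v})) ` U S)"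
  proof
    fix S assume "S \<in> {S \<in> M. card (S \<inter> nbrs G v) = 1}"
    then obtain u where S: "S \<in> independent_sets G" "card S = m" and u: "S \<inter> nbrs G v = {u}"
      by (auto simp: M_def card_1_singleton_iff)
    define S' where "S' = insert v (S - {u})"
    have uS: "u \<in> S" "u \<in> nbrs G v" using u by auto
    have vS: "v \<notin> S" using uS S by (auto simp: nbrs_def independent_sets_def)
    have "S - {u} \<in> independent_sets G" using S by (auto simp: independent_sets_def)
    then have "S' \<in> independent_sets G"
      unfolding S'_def by (rule independent_set_insert[OF G]) (use v u in auto)
    moreover have "card S' = m"
      using card_Suc_Diff1[OF finS[OF S(1)] uS(1)] vS finS[OF S(1)] S(2) by (simp add: S'_def)
    ultimately have S'M: "S' \<in> {S \<in> M. v \<in> S}" by (auto simp: M_def S'_def)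
    have "u \<in> U S'"
      using uS S arc_sym[OF G, of u v] by (auto simp: U_def S'_def nbrs_def independent_sets_def)
    moreover have "S = insert u (S' - {v})" using vS uS by (auto simp: S'_def)
    ultimately show "S \<in> (\<Union>S\<in>{S \<in> M. v \<in> S}. (\<lambda>u. insert u (S - {v})) ` U S)"
      using S'M by blast
  qed
  then have "card {S \<in> M. card (S \<inter> nbrs G v) = 1}
      \<le> card (\<Union>S\<in>{S \<in> M. v \<in> S}. (\<lambda>u. insert u (S - {v})) ` U S)"
    by (intro card_mono) (use finM finU in auto)
  also have "\<dots> \<le> (\<Sum>S\<in>{S \<in> M. v \<in> S}. card ((\<lambda>u. insert u (S - {v})) ` U S))"
    using finM by (intro card_UN_le) auto
  also have "\<dots> \<le> (\<Sum>S\<in>{S \<in> M. v \<in> S}. clique_number G - 1)"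
    by (intro sum_mono order_trans[OF card_image_le[OF finU]]) (use cardU in auto)
  finally show ?thesis by simp
qed

text \<open>
  Let $M$ be the family of maximum independent sets and $m$ their size. For a vertex $v$ let
  $N_0$, $N_1$ count the members of $M$ that contain no neighbour, exactly one neighbour of $v$.
  By maximality $N_0$ counts the sets through $v$, and $N_1 \le (\omega - 1) N_0$ by the exchange
  argument. Hence
  $\sum_{S \in M} |S \cap N(v)| \ge 2|M| - 2N_0 - N_1 \ge 2|M| - (\omega + 1) N_0$.
  Summed over all $v$, the left side is at most $|M| m \Delta$ and the numbers $N_0$ add up to
  $|M| m$, which leaves $m (\Delta + \omega + 1) \ge 2n$.
\<close>

lemma independence_ratio_lower_bound:
  assumes G: "pair_graph G" and ne: "pverts G \<noteq> {}"
  obtains T where "T \<in> independent_sets G" "T \<noteq> {}"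
    "2 * card (pverts G) \<le> card T * (max_degree G + clique_number G + 1)"
proof -
  define m where "m = Max (card ` independent_sets G)"
  define M where "M = {S \<in> independent_sets G. card S = m}"
  define q where "q = clique_number G"
  have fin: "finite (independent_sets G)" by (rule finite_independent_sets[OF G])
  have finV: "finite (pverts G)" by (rule finite_pverts[OF G])
  have finM: "finite M" using fin by (simp add: M_def)
  have max: "card I \<le> m" if "I \<in> independent_sets G" for I
    unfolding m_def using fin that by simp
  have "{} \<in> independent_sets G" by (simp add: independent_sets_def)
  then have "m \<in> card ` independent_sets G"
    unfolding m_def using fin by (intro Max_in) auto
  then obtain T where T: "T \<in> independent_sets G" "card T = m" by auto
  obtain z where z: "z \<in> pverts G" using ne by blast
  have "{z} \<in> independent_sets G" using z arc_irrefl[OF G] by (auto simp: independent_sets_def)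
  from max[OF this] have m0: "m > 0" by simp
  have "{z} \<in> cliques G" using z by (simp add: cliques_def)
  from card_clique_le[OF G this] have q0: "q \<ge> 1" by (simp add: q_def)
  have TM: "T \<in> M" using T by (simp add: M_def)
  have finS: "finite S" if "S \<in> independent_sets G" for S
    using that finV finite_subset by (auto simp: independent_sets_def)
  have local_bound: "2 * card M \<le> (\<Sum>S\<in>M. card (S \<inter> nbrs G v)) + (q + 1) * card {S \<in> M. v \<in> S}"
    if v: "v \<in> pverts G" for v
  proof -
    define d where "d = (\<lambda>S. card (S \<inter> nbrs G v))"
    have point: "2 \<le> d S + of_bool (d S = 1) + 2 * of_bool (v \<in> S)" if S: "S \<in> M" for S
    proof (cases "v \<in> S \<or> d S \<noteq> 0")
      case False
      have ind: "S \<in> independent_sets G" "card S = m" using S by (auto simp: M_def)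
      have "S \<inter> nbrs G v = {}" using False finS[OF ind(1)] by (simp add: d_def)
      then have "insert v S \<in> independent_sets G"
        by (intro independent_set_insert[OF G ind(1) v]) auto
      from max[OF this] show ?thesis using False finS[OF ind(1)] ind(2) by simp
    qed (cases "v \<in> S"; simp; arith)+
    have "2 * card M = (\<Sum>S\<in>M. 2)" by simp
    also have "\<dots> \<le> (\<Sum>S\<in>M. d S + of_bool (d S = 1) + 2 * of_bool (v \<in> S))"
      using point by (rule sum_mono)
    also have "\<dots> = (\<Sum>S\<in>M. d S) + card {S \<in> M. d S = 1} + 2 * card {S \<in> M. v \<in> S}"
      using finM by (simp add: sum.distrib sum_distrib_left[symmetric] of_bool_def
          sum.If_cases Int_def)
    also have "\<dots> \<le> (\<Sum>S\<in>M. d S) + card {S \<in> M. v \<in> S} * (q - 1) + 2 * card {S \<in> M. v \<in> S}"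
      using card_maximum_independent_sets_one_nbr[OF G v max]
      by (simp add: d_def M_def q_def)
    also have "\<dots> = (\<Sum>S\<in>M. d S) + (q + 1) * card {S \<in> M. v \<in> S}"
      using q0 by (cases q) (auto simp: algebra_simps)
    finally show ?thesis by (simp add: d_def)
  qed
  have deg: "(\<Sum>v\<in>pverts G. card (S \<inter> nbrs G v)) \<le> m * max_degree G" if "S \<in> M" for S
  proof -
    have S: "S \<subseteq> pverts G" "card S = m" "finite S"
      using that finS by (auto simp: M_def independent_sets_def)
    have "(\<Sum>v\<in>pverts G. card (S \<inter> nbrs G v)) = (\<Sum>v\<in>pverts G. \<Sum>u | u \<in> S \<and> (v, u) \<in> parcs G. 1)"
      by (simp add: nbrs_def Int_def)
    also have "\<dots> = (\<Sum>u\<in>S. \<Sum>v | v \<in> pverts G \<and> (v, u) \<in> parcs G. 1)"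
      by (rule sum.swap_restrict) (use finV S in auto)
    also have "\<dots> = (\<Sum>u\<in>S. card (nbrs G u))"
      using arc_sym[OF G] arc_in_pverts[OF G]
      by (auto simp: nbrs_def intro!: sum.cong arg_cong[where f = card])
    also have "\<dots> \<le> (\<Sum>u\<in>S. max_degree G)"
      using S card_nbrs_le_max_degree[OF G] by (intro sum_mono) auto
    finally show ?thesis using S by simp
  qed
  have "card (pverts G) * (2 * card M) = (\<Sum>v\<in>pverts G. 2 * card M)" by simp
  also have "\<dots> \<le> (\<Sum>v\<in>pverts G. (\<Sum>S\<in>M. card (S \<inter> nbrs G v)) + (q + 1) * card {S \<in> M. v \<in> S})"
    using local_bound by (rule sum_mono)
  also have "\<dots> = (\<Sum>S\<in>M. \<Sum>v\<in>pverts G. card (S \<inter> nbrs G v))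
      + (q + 1) * (\<Sum>v\<in>pverts G. card {S \<in> M. v \<in> S})"
    by (simp only: sum.distrib sum_distrib_left sum.swap[of _ M])
  also have "(\<Sum>v\<in>pverts G. card {S \<in> M. v \<in> S}) = card M * m"
    using sum_card_containing[OF finV finM] by (force simp: M_def independent_sets_def)
  also have "(\<Sum>S\<in>M. \<Sum>v\<in>pverts G. card (S \<inter> nbrs G v)) \<le> card M * (m * max_degree G)"
    using sum_mono[OF deg] by simp
  finally have "card M * (2 * card (pverts G)) \<le> card M * (m * (max_degree G + q + 1))"
    by (simp add: algebra_simps)
  moreover have "card M > 0" using TM finM by (auto simp: card_gt_0_iff)
  ultimately have "2 * card (pverts G) \<le> m * (max_degree G + q + 1)" by simp
  then have "2 * card (pverts G) \<le> card T * (max_degree G + clique_number G + 1)"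
    using T by (simp add: q_def)
  moreover have "T \<noteq> {}" using T m0 by auto
  ultimately show ?thesis using that T by blast
qed

section \<open>Independent transversals\<close>

text \<open>
  The classes of a partition are the fibres of a map \<open>c\<close>, and \<open>J\<close> lists the classes to be met.
  With this encoding two classes are merged by changing \<open>c\<close> alone, and vertices whose class is
  outside \<open>J\<close> are ignored.
\<close>

definition independent_transversal ::
  "'v set \<Rightarrow> ('v \<Rightarrow> 'i) \<Rightarrow> 'i set \<Rightarrow> ('v \<times> 'v) set \<Rightarrow> 'v set \<Rightarrow> bool" where
  "independent_transversal V c J E T \<longleftrightarrow>
     T \<subseteq> V \<and> inj_on c T \<and> c ` T = J \<and> (\<forall>u\<in>T. \<forall>v\<in>T. (u, v) \<notin> E)"

text \<open>
  The hypothesis describes the graph obtained by deleting all neighbours of $x$ and $y$ and merging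
  their classes. A transversal there has a single vertex in the merged class, so one of the two
  original classes is still missed; $x$ or $y$ fills it, having no neighbour among the vertices
  that remain.
\<close>

lemma independent_transversal_split_class:
  assumes E: "sym E" "irrefl E"
    and xy: "x \<in> V" "y \<in> V" "c x \<in> J" "c y \<in> J" "c x \<noteq> c y"
    and T: "independent_transversal {v \<in> V. (v, x) \<notin> E \<and> (v, y) \<notin> E}
      (\<lambda>v. if c v = c y then c x else c v) (J - {c y}) E T"
  shows "\<exists>T. independent_transversal V c J E T"
proof -
  define c' where "c' = (\<lambda>v. if c v = c y then c x else c v)"
  have TV: "T \<subseteq> V" "inj_on c' T" "c' ` T = J - {c y}"
    and TE: "\<And>u v. u \<in> T \<Longrightarrow> v \<in> T \<Longrightarrow> (u, v) \<notin> E"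
    and Txy: "\<And>v. v \<in> T \<Longrightarrow> (v, x) \<notin> E \<and> (v, y) \<notin> E"
    using T[folded c'_def] unfolding independent_transversal_def by blast+
  have "c x \<in> c' ` T" using TV(3) xy by simp
  then obtain t where t: "t \<in> T" "c' t = c x" by auto
  have ct: "c t = c x \<or> c t = c y" using t by (auto simp: c'_def split: if_splits)
  have other: "c u \<noteq> c x \<and> c u \<noteq> c y" if "u \<in> T" "u \<noteq> t" for u
  proof -
    have "c' u \<noteq> c x" using inj_onD[OF TV(2), of u t] that t by auto
    then show ?thesis by (simp add: c'_def split: if_splits)
  qed
  have injc: "inj_on c T"
  proof (rule inj_onI)
    fix u v assume "u \<in> T" "v \<in> T" "c u = c v"
    then show "u = v" using inj_onD[OF TV(2), of u v] by (simp add: c'_def)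
  qed
  have img: "c ` T = insert (c t) (J - {c x, c y})"
  proof -
    have eq: "c' ` (T - {t}) = c ` (T - {t})"
      using other by (intro image_cong) (auto simp: c'_def)
    have "c' ` (T - {t}) = J - {c y} - {c x}"
      using inj_on_image_set_diff[OF TV(2), of T "{t}"] t TV(3) by auto
    then have "c ` (T - {t}) = J - {c x, c y}" using eq by auto
    then show ?thesis using t(1) by (metis image_insert insert_Diff)
  qed
  have ext: "independent_transversal V c J E (insert z T)"
    if z: "z \<in> {x, y}" "{c z, c t} = {c x, c y}" "c z \<noteq> c t" for z
    unfolding independent_transversal_def
  proof (intro conjI ballI)
    show "insert z T \<subseteq> V" using z TV(1) xy by auto
    have "c z \<notin> c ` T" using img z by auto
    then show "inj_on c (insert z T)" using injc by auto
    have "c ` insert z T = {c z, c t} \<union> (J - {c x, c y})" using img by auto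
    also have "\<dots> = J" unfolding z(2) using xy by auto
    finally show "c ` insert z T = J" .
    show "(u, v) \<notin> E" if "u \<in> insert z T" "v \<in> insert z T" for u v
      using that TE Txy z(1) E unfolding irrefl_def by (blast dest: symD)
  qed
  from ct show ?thesis
  proof
    assume "c t = c x"
    then show ?thesis using ext[of y] xy by auto
  next
    assume "c t = c y"
    then show ?thesis using ext[of x] xy by auto
  qed
qed

text \<open>
  The combinatorial core of Haxell's theorem, by induction on the number of classes. If class $X$
  is empty, then $S = \{X\}$ and $D = \emptyset$ work. Otherwise $T$ extends into $X$ once all
  edges between $X$ and $T$ are removed. Remove as few of these edges as possible; restoring one
  of them, $xy$, destroys every transversal, so some transversal $T_2$ of the graph without $xy$
  contains $x$ and $y$, and $xy$ is the only edge on it. Now delete the neighbours of $x$ and $y$ and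
  merge their classes. The rest of $T_2$ survives and misses only the merged class, while a full
  transversal would lift back. So the induction hypothesis applies, and adding $x$ and $y$ to the
  dominating set it provides accounts for the deleted vertices: one more class, two more
  dominating vertices. The requirement \<open>X \<in> S\<close> is what makes this work, since it ensures that the
  merged class, and hence both of its parts, belong to the dominated collection.
\<close>

lemma no_transversal_imp_dominating_set:
  assumes "finite V" "finite J" "sym E" "irrefl E" "X \<in> J"
    and "independent_transversal V c (J - {X}) E T"
    and "\<nexists>T. independent_transversal V c J E T"
  shows "\<exists>S D. S \<subseteq> J \<and> X \<in> S \<and> D \<subseteq> V \<and> card D + 2 \<le> 2 * card S \<and>
    (\<forall>v\<in>V. c v \<in> S \<longrightarrow> (\<exists>d\<in>D. (v, d) \<in> E))"
  using assms
proof (induction "card J" arbitrary: V J E c T rule: less_induct)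
  case less
  note finV = \<open>finite V\<close> and finJ = \<open>finite J\<close> and symE = \<open>sym E\<close> and irr = \<open>irrefl E\<close>
    and XJ = \<open>X \<in> J\<close> and T = \<open>independent_transversal V c (J - {X}) E T\<close>
    and none = \<open>\<nexists>T. independent_transversal V c J E T\<close>
  show ?case
  proof (cases "\<exists>w\<in>V. c w = X")
    case False
    then show ?thesis
      using XJ by (intro exI[of _ "{X}"] exI[of _ "{}"]) auto
  next
    case True
    then obtain w where w: "w \<in> V" "c w = X" by blast
    define C where "C = {(x, y). (x, y) \<in> E \<and> x \<in> V \<and> c x = X \<and> y \<in> T}"
    define P where "P = (\<lambda>R. R \<subseteq> C \<and> (\<exists>T'. independent_transversal V c J (E - (R \<union> R\<inverse>)) T'))"
    have TV: "T \<subseteq> V" "inj_on c T" "c ` T = J - {X}" "\<And>u v. u \<in> T \<Longrightarrow> v \<in> T \<Longrightarrow> (u, v) \<notin> E"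
      using T by (auto simp: independent_transversal_def)
    have finC: "finite C"
      by (rule finite_subset[of _ "V \<times> V"]) (use TV finV in \<open>auto simp: C_def\<close>)
    have "independent_transversal V c J (E - (C \<union> C\<inverse>)) (insert w T)"
      unfolding independent_transversal_def
    proof (intro conjI ballI)
      show "insert w T \<subseteq> V" using w TV by auto
      show "inj_on c (insert w T)" using w TV by auto
      show "c ` insert w T = J" using w TV XJ by auto
    next
      fix u v assume "u \<in> insert w T" "v \<in> insert w T"
      then show "(u, v) \<notin> E - (C \<union> C\<inverse>)"
        using w TV(4) irr symE by (auto simp: C_def irrefl_def dest: symD)
    qed
    then have "P C" unfolding P_def by blast
    then obtain R where R: "P R" "\<And>R'. P R' \<Longrightarrow> card R \<le> card R'"
      using ex_has_least_nat[of P C card] by blast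
    then have RC: "R \<subseteq> C" by (simp add: P_def)
    have "R \<noteq> {}" using R(1) none by (auto simp: P_def)
    then obtain x y where xy: "(x, y) \<in> R" by auto
    have xy': "(x, y) \<in> E" "x \<in> V" "c x = X" "y \<in> T" "y \<in> V" "c y \<in> J" "c y \<noteq> X"
      using xy RC TV by (auto simp: C_def)
    define Y where "Y = c y"
    \<comment> \<open>by minimality of \<open>R\<close>, restoring \<open>xy\<close> alone leaves no transversal\<close>
    define E' where "E' = E - ((R - {(x, y)}) \<union> (R - {(x, y)})\<inverse>)"
    have E'E: "E' \<subseteq> E" by (auto simp: E'_def)
    have symE': "sym E'"
    proof (rule symI)
      fix a b assume "(a, b) \<in> E'"
      then show "(b, a) \<in> E'" using symD[OF symE, of a b] unfolding E'_def by blast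
    qed
    have irrE': "irrefl E'" using irr E'E unfolding irrefl_def by blast
    have none': "\<nexists>T. independent_transversal V c J E' T"
    proof
      assume "\<exists>T. independent_transversal V c J E' T"
      then have "P (R - {(x, y)})" using RC by (auto simp: P_def E'_def)
      then have "card R \<le> card (R - {(x, y)})" by (rule R(2))
      moreover have "card (R - {(x, y)}) < card R"
        using xy RC finC finite_subset by (intro psubset_card_mono) auto
      ultimately show False by simp
    qed
    obtain T2 where T2: "independent_transversal V c J (E - (R \<union> R\<inverse>)) T2"
      using R(1) by (auto simp: P_def)
    have E'eq: "E' \<subseteq> (E - (R \<union> R\<inverse>)) \<union> {(x, y), (y, x)}"
      by (auto simp: E'_def)
    have T2f: "T2 \<subseteq> V" "inj_on c T2" "c ` T2 = J"
      and T2i: "\<And>u v. u \<in> T2 \<Longrightarrow> v \<in> T2 \<Longrightarrow> (u, v) \<in> E' \<Longrightarrow> (u, v) = (x, y) \<or> (u, v) = (y, x)"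
      using T2 E'eq by (auto simp: independent_transversal_def)
    have xT2: "x \<in> T2" and yT2: "y \<in> T2"
    proof -
      have "\<not> independent_transversal V c J E' T2" using none' by blast
      then obtain u v where "u \<in> T2" "v \<in> T2" "(u, v) \<in> E'"
        using T2f by (auto simp: independent_transversal_def)
      then show "x \<in> T2" "y \<in> T2" using T2i by blast+
    qed
    define V' where "V' = {v \<in> V. (v, x) \<notin> E' \<and> (v, y) \<notin> E'}"
    define c' where "c' = (\<lambda>v. if c v = Y then X else c v)"
    define J' where "J' = J - {Y}"
    have YJ: "Y \<in> J" "Y \<noteq> X" using xy' by (auto simp: Y_def)
    have uniq: "c u \<noteq> X \<and> c u \<noteq> Y" if "u \<in> T2 - {x, y}" for u
      using that xT2 yT2 T2f(2) xy'(3) by (auto simp: Y_def inj_on_def)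
    have c'T2: "c' u = c u" if "u \<in> T2 - {x, y}" for u
      using uniq[OF that] by (simp add: c'_def)
    have part: "independent_transversal V' c' (J' - {X}) E' (T2 - {x, y})"
      unfolding independent_transversal_def
    proof (intro conjI ballI)
      show "T2 - {x, y} \<subseteq> V'" using T2f(1) T2i xT2 yT2 by (auto simp: V'_def)
      show "inj_on c' (T2 - {x, y})"
        using T2f(2) c'T2 by (simp add: inj_on_def)
      have "c' ` (T2 - {x, y}) = c ` (T2 - {x, y})"
        using c'T2 by (intro image_cong) auto
      also have "\<dots> = c ` T2 - c ` {x, y}"
        using T2f(2) xT2 yT2 by (intro inj_on_image_set_diff[of c T2]) auto
      also have "\<dots> = J' - {X}" using T2f(3) xy'(3) by (auto simp: J'_def Y_def)
      finally show "c' ` (T2 - {x, y}) = J' - {X}" .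
      show "(u, v) \<notin> E'" if "u \<in> T2 - {x, y}" "v \<in> T2 - {x, y}" for u v
        using T2i that by blast
    qed
    have none'': "\<nexists>T. independent_transversal V' c' J' E' T"
      using independent_transversal_split_class[OF symE' irrE' xy'(2,5), of c J] xy' XJ none'
      unfolding V'_def c'_def J'_def Y_def by auto
    have "card J' < card J" unfolding J'_def using YJ finJ by (meson card_Diff1_less)
    then obtain S' D' where S': "S' \<subseteq> J'" "X \<in> S'" "D' \<subseteq> V'" "card D' + 2 \<le> 2 * card S'"
      "\<And>v. v \<in> V' \<Longrightarrow> c' v \<in> S' \<Longrightarrow> \<exists>d\<in>D'. (v, d) \<in> E'"
      using less.hyps[of J' V' E' c' "T2 - {x, y}"] part none'' symE' irrE' finV finJ XJ YJ
      by (fastforce simp: J'_def V'_def)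
    show ?thesis
    proof (intro exI conjI)
      show "insert Y S' \<subseteq> J" "X \<in> insert Y S'" using S' YJ by (auto simp: J'_def)
      show "D' \<union> {x, y} \<subseteq> V" using S'(3) xy' by (auto simp: V'_def)
      have "card (D' \<union> {x, y}) \<le> card D' + card {x, y}" by (rule card_Un_le)
      also have "card {x, y} \<le> 2" by (simp add: card_insert_if)
      finally have "card (D' \<union> {x, y}) \<le> card D' + 2" by simp
      moreover have "card (insert Y S') = Suc (card S')"
        using S'(1) finJ finite_subset[of S' J] by (subst card_insert_disjoint) (auto simp: J'_def)
      ultimately show "card (D' \<union> {x, y}) + 2 \<le> 2 * card (insert Y S')"
        using S'(4) by simp
      show "\<forall>v\<in>V. c v \<in> insert Y S' \<longrightarrow> (\<exists>d\<in>D' \<union> {x, y}. (v, d) \<in> E)"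
      proof (intro ballI impI)
        fix v assume v: "v \<in> V" "c v \<in> insert Y S'"
        show "\<exists>d\<in>D' \<union> {x, y}. (v, d) \<in> E"
        proof (cases "v \<in> V'")
          case True
          have "c' v \<in> S'" using v S'(2) by (auto simp: c'_def)
          then show ?thesis using S'(5)[OF True] E'E by blast
        next
          case False
          then show ?thesis using v E'E by (auto simp: V'_def)
        qed
      qed
    qed
  qed
qed

text \<open>
  Haxell's theorem. Add the classes one at a time. If no transversal existed at some stage, the
  $|S|$ classes given by the preceding lemma would have at least $|S| k$ vertices, all of them
  adjacent to a set of at most $2(|S| - 1)$ vertices, which dominates no more than
  $2(|S| - 1)d < |S| k$ vertices.
\<close>

lemma independent_transversal_exists:
  assumes fin: "finite V" "finite J" and E: "sym E" "irrefl E"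
    and deg: "\<And>v. v \<in> V \<Longrightarrow> card {u \<in> V. (v, u) \<in> E} \<le> d"
    and size: "\<And>i. i \<in> J \<Longrightarrow> k \<le> card {v \<in> V. c v = i}"
    and k: "2 * d \<le> k" "0 < k"
  shows "\<exists>T. independent_transversal V c J E T"
  using fin(2) size
proof (induction J rule: finite_induct)
  case empty
  show ?case by (rule exI[of _ "{}"]) (simp add: independent_transversal_def)
next
  case (insert X J)
  then obtain T where T: "independent_transversal V c J E T" by auto
  show ?case
  proof (rule ccontr)
    assume none: "\<nexists>T. independent_transversal V c (insert X J) E T"
    obtain S D where SD: "S \<subseteq> insert X J" "X \<in> S" "D \<subseteq> V" "card D + 2 \<le> 2 * card S"
      "\<And>v. v \<in> V \<Longrightarrow> c v \<in> S \<Longrightarrow> \<exists>d\<in>D. (v, d) \<in> E"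
      using no_transversal_imp_dominating_set[OF fin(1) _ E _ _ none, of X T] T insert.hyps
      by auto
    have finS: "finite S" using SD(1) insert.hyps(1) finite_subset by auto
    have finD: "finite D" using SD(3) fin(1) finite_subset by auto
    have "card S * k = (\<Sum>i\<in>S. k)" by simp
    also have "\<dots> \<le> (\<Sum>i\<in>S. card {v \<in> V. c v = i})"
      using insert.prems SD(1) by (intro sum_mono) auto
    also have "\<dots> = card (\<Union>i\<in>S. {v \<in> V. c v = i})"
      using finS fin(1) by (intro card_UN_disjoint[symmetric]) auto
    also have "\<dots> \<le> card (\<Union>x\<in>D. {u \<in> V. (x, u) \<in> E})"
    proof (rule card_mono)
      show "finite (\<Union>x\<in>D. {u \<in> V. (x, u) \<in> E})" using finD fin(1) by auto
      show "(\<Union>i\<in>S. {v \<in> V. c v = i}) \<subseteq> (\<Union>x\<in>D. {u \<in> V. (x, u) \<in> E})"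
        using SD(5) E(1) by (fastforce dest: symD)
    qed
    also have "\<dots> \<le> (\<Sum>x\<in>D. card {u \<in> V. (x, u) \<in> E})"
      using finD by (rule card_UN_le)
    also have "\<dots> \<le> (\<Sum>x\<in>D. d)" using deg SD(3) by (intro sum_mono) auto
    also have "\<dots> = card D * d" by simp
    finally have 1: "card S * k \<le> card D * d" .
    have "card D * d + 2 * d \<le> card S * (2 * d)"
      using mult_right_mono[OF SD(4), of d] by (simp add: algebra_simps)
    also have "\<dots> \<le> card S * k" using k by simp
    finally have "d = 0" using 1 by simp
    then have "card S = 0" using 1 k by simp
    then show False using finS SD(2) by simp
  qed
qed

section \<open>Large cliques partition the vertices\<close>

text \<open>
  Hajnal's inequality. When a clique $A$ is added to a collection $R$, the vertices of $A$ that are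
  covered by $R$ form a clique together with the common vertices of $R$, because a common vertex
  lies in a clique of $R$ with every covered vertex. This clique has at most $\omega$ vertices, and
  that bounds how much the intersection can shrink in terms of how much the union grows.
\<close>

lemma maximum_cliques_Int_Un:
  assumes G: "pair_graph G"
    and Q: "finite Q" "Q \<noteq> {}" "\<And>K. K \<in> Q \<Longrightarrow> K \<in> cliques G \<and> card K = clique_number G"
  shows "2 * clique_number G \<le> card (\<Inter>Q) + card (\<Union>Q)"
  using Q
proof (induction Q rule: finite_ne_induct)
  case (singleton A)
  then show ?case by simp
next
  case (insert A R)
  have finK: "finite K" if "K \<in> cliques G" for K
    using that finite_pverts[OF G] finite_subset by (auto simp: cliques_def)
  have finA: "finite A" using finK insert.prems by blast
  have finUR: "finite (\<Union>R)" using finK insert by blast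
  have finIR: "finite (\<Inter>R)" using finK insert by (metis Inter_lower equals0I insertCI rev_finite_subset)
  define K where "K = (A \<inter> \<Union>R) \<union> \<Inter>R"
  have IU: "\<Inter>R \<subseteq> \<Union>R" using insert.hyps(2) by blast
  have adj: "(u, v) \<in> parcs G" if "B \<in> insert A R" "u \<in> B" "v \<in> B" "u \<noteq> v" for u v B
    using insert.prems[OF that(1)] that by (auto simp: cliques_def)
  have sub: "B \<subseteq> pverts G" if "B \<in> insert A R" for B
    using insert.prems[OF that] by (auto simp: cliques_def)
  have "K \<in> cliques G"
    unfolding cliques_def
  proof (intro CollectI conjI ballI impI)
    have "\<Union>R \<subseteq> pverts G" using sub by (intro Union_least) simp
    then show "K \<subseteq> pverts G" using IU by (auto simp only: K_def)
    fix u v assume uv: "u \<in> K" "v \<in> K" "u \<noteq> v"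
    have "\<exists>B\<in>insert A R. u \<in> B \<and> v \<in> B"
      using uv(1,2) insert.hyps(2) unfolding K_def by blast
    then show "(u, v) \<in> parcs G" using adj uv(3) by blast
  qed
  then have "card K \<le> clique_number G" by (rule card_clique_le[OF G])
  moreover have "card (A \<inter> \<Union>R) + card (\<Inter>R) = card K + card (A \<inter> \<Inter>R)"
  proof -
    have "(A \<inter> \<Union>R) \<inter> \<Inter>R = A \<inter> \<Inter>R" using IU by blast
    then show ?thesis unfolding K_def using card_Un_Int[of "A \<inter> \<Union>R" "\<Inter>R"] finA finIR by simp
  qed
  moreover have "card A + card (\<Union>R) = card (A \<union> \<Union>R) + card (A \<inter> \<Union>R)"
    using finA finUR by (rule card_Un_Int)
  moreover have "card A = clique_number G" using insert.prems by simp
  moreover have "2 * clique_number G \<le> card (\<Inter>R) + card (\<Union>R)"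
    using insert.IH insert.prems by simp
  ultimately show ?case by simp
qed

text \<open>
  Let $D_v$ be the intersection of the maximum cliques through $v$. Their union lies in the closed
  neighbourhood of $v$, so Hajnal's inequality gives $|D_v| > \omega/2$. If $u \in D_v$, then every
  maximum clique through $v$ passes through $u$, and since all vertices lie in equally many maximum
  cliques, $D_u = D_v$. Thus the sets $D_v$ are pairwise equal or disjoint, and a maximum clique
  has room for only one of them.
\<close>

lemma unique_maximum_clique:
  assumes G: "pair_graph G" "vertex_transitive G"
    and large: "2 * (max_degree G + 1) < 3 * clique_number G"
    and v: "v \<in> pverts G"
  shows "\<exists>!K. K \<in> cliques G \<and> card K = clique_number G \<and> v \<in> K"
proof -
  define M where "M = {K \<in> cliques G. card K = clique_number G}"
  define Q where "Q = (\<lambda>v. {K \<in> M. v \<in> K})"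
  have finM: "finite M" using finite_cliques[OF G(1)] by (simp add: M_def)
  have MV: "M \<subseteq> Pow (pverts G)" by (auto simp: M_def cliques_def)
  have finK: "finite K" if "K \<in> M" for K
    using that MV finite_pverts[OF G(1)] finite_subset by blast
  have inv: "f ` K \<in> M" if "automorphism G f" "K \<in> M" for f K
    using that automorphism_image_clique[of G f K] automorphism_image(2)[of G f K] MV
    by (auto simp: M_def)
  have same: "card (Q x) = card (Q y)" if "x \<in> pverts G" "y \<in> pverts G" for x y
    unfolding Q_def using card_containing_const[OF G MV inv] that by blast
  have finQ: "finite (Q x)" for x using finM by (simp add: Q_def)
  have Qne: "Q x \<noteq> {}" if x: "x \<in> pverts G" for x
  proof -
    obtain K where K: "K \<in> cliques G" "card K = clique_number G"
      using maximum_clique_exists[OF G(1)] .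
    then have "K \<noteq> {}" using large by auto
    then obtain y where "y \<in> K" by blast
    then have y: "K \<in> Q y" "y \<in> pverts G" using K by (auto simp: Q_def M_def cliques_def)
    then have "card (Q y) \<noteq> 0" using finQ by auto
    then have "card (Q x) \<noteq> 0" using same[OF x y(2)] by simp
    then show ?thesis by auto
  qed
  have half: "clique_number G < 2 * card (\<Inter>(Q x))" if x: "x \<in> pverts G" for x
  proof -
    have "\<Union>(Q x) \<subseteq> insert x (nbrs G x)"
      by (auto simp: Q_def M_def cliques_def nbrs_def)
    then have "card (\<Union>(Q x)) \<le> card (insert x (nbrs G x))"
      using nbrs_subset(2)[OF G(1)] by (intro card_mono) auto
    also have "\<dots> \<le> Suc (card (nbrs G x))" by (rule card_insert_le_m1) auto
    also have "\<dots> \<le> max_degree G + 1" using card_nbrs_le_max_degree[OF G(1) x] by simp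
    finally have "card (\<Union>(Q x)) \<le> max_degree G + 1" .
    moreover have "2 * clique_number G \<le> card (\<Inter>(Q x)) + card (\<Union>(Q x))"
      by (rule maximum_cliques_Int_Un[OF G(1) finQ Qne[OF x]]) (auto simp: Q_def M_def)
    ultimately show ?thesis using large by arith
  qed
  have Qeq: "Q u = Q x" if "x \<in> pverts G" "u \<in> \<Inter>(Q x)" for u x
  proof -
    have "u \<in> pverts G" using Qne[OF that(1)] that(2) MV by (auto simp: Q_def)
    moreover have "Q x \<subseteq> Q u" using that(2) by (auto simp: Q_def)
    ultimately show ?thesis using card_subset_eq[OF finQ] same that(1) by metis
  qed
  have core: "K = \<Inter>(Q v)" if K: "K \<in> Q v" for K
  proof (rule ccontr)
    assume "K \<noteq> \<Inter>(Q v)"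
    then obtain u where u: "u \<in> K" "u \<notin> \<Inter>(Q v)" using K by blast
    have KM: "K \<in> M" and uV: "u \<in> pverts G" using K u MV by (auto simp: Q_def)
    have "\<Inter>(Q u) \<inter> \<Inter>(Q v) = {}"
    proof (rule ccontr)
      assume "\<Inter>(Q u) \<inter> \<Inter>(Q v) \<noteq> {}"
      then obtain z where z: "z \<in> \<Inter>(Q u)" "z \<in> \<Inter>(Q v)" by blast
      have "Q u = Q v" using Qeq[OF uV z(1)] Qeq[OF v z(2)] by simp
      then show False using u(2) by (auto simp: Q_def)
    qed
    moreover have sub: "\<Inter>(Q u) \<subseteq> K" "\<Inter>(Q v) \<subseteq> K" using K u KM by (auto simp: Q_def)
    ultimately have "card (\<Inter>(Q u)) + card (\<Inter>(Q v)) = card (\<Inter>(Q u) \<union> \<Inter>(Q v))"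
      using sub[THEN finite_subset, OF finK[OF KM]] by (simp add: card_Un_disjoint)
    also have "\<dots> \<le> card K" using sub finK[OF KM] by (intro card_mono) auto
    also have "card K = clique_number G" using KM by (simp add: M_def)
    finally show False using half[OF uV] half[OF v] by linarith
  qed
  obtain K where K: "K \<in> Q v" using Qne[OF v] by blast
  show ?thesis
  proof (rule ex1I[of _ K])
    show "K \<in> cliques G \<and> card K = clique_number G \<and> v \<in> K"
      using K by (auto simp: Q_def M_def)
    show "L = K" if "L \<in> cliques G \<and> card L = clique_number G \<and> v \<in> L" for L
    proof -
      have "L \<in> Q v" using that by (simp add: Q_def M_def)
      then show ?thesis using core K by metis
    qed
  qed
qed

section \<open>The bound\<close>

text \<open>
  Outside its own maximum clique a vertex has at most $\Delta + 1 - \omega < \omega/2$ neighbours,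
  so there is an independent set with one vertex in each of the $n/\omega$ maximum cliques.
\<close>

lemma independent_set_meeting_maximum_cliques:
  assumes G: "pair_graph G" "vertex_transitive G" and ne: "pverts G \<noteq> {}"
    and large: "2 * (max_degree G + 1) < 3 * clique_number G"
  obtains T where "T \<in> independent_sets G" "T \<noteq> {}"
    "card T * clique_number G = card (pverts G)"
proof -
  define M where "M = {K \<in> cliques G. card K = clique_number G}"
  define c where "c = (\<lambda>v. THE K. K \<in> cliques G \<and> card K = clique_number G \<and> v \<in> K)"
  define E where "E = {(u, v). (u, v) \<in> parcs G \<and> c u \<noteq> c v}"
  have finV: "finite (pverts G)" by (rule finite_pverts[OF G(1)])
  have finM: "finite M" using finite_cliques[OF G(1)] by (simp add: M_def)
  have MV: "M \<subseteq> Pow (pverts G)" by (auto simp: M_def cliques_def)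
  have cM: "c v \<in> M" "v \<in> c v" if "v \<in> pverts G" for v
    using theI'[OF unique_maximum_clique[OF G large that]] by (auto simp: c_def M_def)
  have ceq: "c v = K" if "K \<in> M" "v \<in> K" for v K
    unfolding c_def
    by (rule the1_equality[OF unique_maximum_clique[OF G large]])
       (use that MV in \<open>auto simp: M_def\<close>)
  have part: "{v \<in> pverts G. c v = K} = K" if "K \<in> M" for K
    using that cM ceq MV by auto
  have "\<exists>T. independent_transversal (pverts G) c M E T"
  proof (rule independent_transversal_exists[where k = "clique_number G"])
    show "sym E" using arc_sym[OF G(1)] by (auto simp: E_def sym_def)
    show "irrefl E" by (auto simp: E_def irrefl_def)
    show "clique_number G \<le> card {v \<in> pverts G. c v = K}" if "K \<in> M" for K
      using part[OF that] that by (simp add: M_def)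
    show "2 * (max_degree G - (clique_number G - 1)) \<le> clique_number G" "0 < clique_number G"
      using large by arith+
    show "card {u \<in> pverts G. (v, u) \<in> E} \<le> max_degree G - (clique_number G - 1)"
      if v: "v \<in> pverts G" for v
    proof -
      have K: "c v \<in> cliques G" "card (c v) = clique_number G" using cM(1)[OF v] by (auto simp: M_def)
      have sub: "c v - {v} \<subseteq> nbrs G v" using K cM(2)[OF v] by (auto simp: cliques_def nbrs_def)
      have "{u \<in> pverts G. (v, u) \<in> E} \<subseteq> nbrs G v - (c v - {v})"
        using ceq[OF cM(1)[OF v]] arc_irrefl[OF G(1)] by (auto simp: E_def nbrs_def)
      then have "card {u \<in> pverts G. (v, u) \<in> E} \<le> card (nbrs G v - (c v - {v}))"
        using nbrs_subset(2)[OF G(1)] by (intro card_mono) auto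
      also have "\<dots> = card (nbrs G v) - card (c v - {v})"
        using finite_subset[OF sub nbrs_subset(2)[OF G(1)]] sub by (rule card_Diff_subset)
      also have "card (c v - {v}) = clique_number G - 1" using K cM(2)[OF v] by simp
      finally show ?thesis using card_nbrs_le_max_degree[OF G(1) v] by linarith
    qed
  qed (use finV finM in auto)
  then obtain T where T: "T \<subseteq> pverts G" "inj_on c T" "c ` T = M"
    "\<forall>u\<in>T. \<forall>v\<in>T. (u, v) \<notin> E"
    by (auto simp: independent_transversal_def)
  have ind: "T \<in> independent_sets G"
    unfolding independent_sets_def
  proof (intro CollectI conjI ballI)
    fix u v assume uv: "u \<in> T" "v \<in> T"
    show "(u, v) \<notin> parcs G"
    proof (cases "u = v")
      case False
      then have "c u \<noteq> c v" using inj_onD[OF T(2) _ uv] by blast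
      moreover have "(u, v) \<notin> E" using T(4) uv by blast
      ultimately show ?thesis by (simp add: E_def)
    qed (simp add: arc_irrefl[OF G(1)])
  qed (rule T(1))
  have "M \<noteq> {}" using cM ne by blast
  then have Tne: "T \<noteq> {}" using T(3) by auto
  have one: "card {K \<in> M. v \<in> K} = 1" if "v \<in> pverts G" for v
  proof -
    have "K \<in> M \<and> v \<in> K \<longleftrightarrow> K = c v" for K
      using cM[OF that] ceq[of K v] by metis
    then have "{K \<in> M. v \<in> K} = {c v}" by simp
    then show ?thesis by simp
  qed
  have "card (pverts G) = (\<Sum>v\<in>pverts G. card {K \<in> M. v \<in> K})" using one by simp
  also have "\<dots> = card M * clique_number G"
    using sum_card_containing[OF finV finM MV] by (simp add: M_def)
  also have "card M = card T" using card_image[OF T(2)] T(3) by simp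
  finally show ?thesis by (intro that[OF ind Tne]) (rule sym)
qed

theorem corollary3p5:
  fixes G :: "'a pair_pre_digraph"
  assumes "pair_graph G"
    and "pverts G \<noteq> {}"
    and "vertex_transitive G"
  shows "fractional_chromatic_number G
    \<le> max (real (clique_number G)) (5 / 6 * (real (max_degree G) + 1))"
proof (cases "2 * (max_degree G + 1) < 3 * clique_number G")
  case True
  obtain T where T: "T \<in> independent_sets G" "T \<noteq> {}"
    "card T * clique_number G = card (pverts G)"
    using independent_set_meeting_maximum_cliques[OF assms(1,3,2) True] .
  have "finite T"
    using T(1) finite_pverts[OF assms(1)] finite_subset by (auto simp: independent_sets_def)
  then have "real (card (pverts G)) / real (card T) = real (clique_number G)"
    using T(2) by (simp add: T(3)[symmetric])
  then show ?thesis
    using fractional_chromatic_number_le_ratio[OF assms(1,3) T(1,2)] by simp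
next
  case False
  obtain T where T: "T \<in> independent_sets G" "T \<noteq> {}"
    "2 * card (pverts G) \<le> card T * (max_degree G + clique_number G + 1)"
    using independence_ratio_lower_bound[OF assms(1,2)] .
  have "finite T"
    using T(1) finite_pverts[OF assms(1)] finite_subset by (auto simp: independent_sets_def)
  then have pos: "real (card T) > 0" using T(2) by (simp add: card_gt_0_iff)
  have "2 * real (card (pverts G)) \<le> real (card T) * (real (max_degree G) + real (clique_number G) + 1)"
    using T(3) by (metis (mono_tags) of_nat_1 of_nat_add of_nat_le_iff of_nat_mult of_nat_numeral)
  then have "real (card (pverts G)) / real (card T)
      \<le> (real (max_degree G) + real (clique_number G) + 1) / 2"
    using pos by (simp add: field_simps)
  also have "\<dots> \<le> 5 / 6 * (real (max_degree G) + 1)" using False by simp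
  finally have "fractional_chromatic_number G \<le> 5 / 6 * (real (max_degree G) + 1)"
    using fractional_chromatic_number_le_ratio[OF assms(1,3) T(1,2)] by linarith
  then show ?thesis by (rule max.coboundedI2)
qed

end
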